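(* Let $D$ be an open set in $\mathbb{R}^2$. Let $(t_0,x_0^{(0)})\in D$ and let $a$ and $b$ be positive constants such that the set $$R=\{(t,x):|t-t_0|\le a\text{ and }|x-x_0^{(0)}|\le b\}$$ is contained in $D$. Suppose the function $f$ is continuous and defined on $D$ and satisfies a Lipschitz condition with respect to $x$ in $R$ with Lipschitz constant $L$. Let $M=\max_{(t,x)\in R}|f(t,x)|$ and $A=\min\{a,\frac{b}{M}\}$. Consider the initial value problem $$\frac{dx}{dt}=f(t,x),\qquad x(t_0)=x_0^{(0)},$$ and its unique solution $x=x(t)$ on the open interval $I=\,]t_0-A,t_0+A[$. Consider also the algorithm (IFOHAM) $$u_0(t)=x_0^{(0)},\qquad \mathcal{L}[u_{m+1}(t)]=c_0\Big[\sum_{k=0}^{m}u_k'(t)-f\Big(t,\sum_{k=0}^{m}u_k(t)\Big)\Big],\ m\ge0,\qquad\text{with }u_k(t_0)=0\ \ \forall k\in\mathbb{N},$$ with $\mathcal{L}[h(t)]=\frac{dh}{dt}(t)$ and $\mathcal{L}^{-1}[h(t)]=\int_{t_0}^{t}h(\xi)\,d\xi$, and the algorithm $$x_0(t)=x_0^{(0)},\qquad x_{m+1}(t)=x_0^{(0)}+(1+c_0)\int_{t_0}^{t}\frac{dx_m}{dt}(\xi)\,d\xi-c_0\int_{t_0}^{t}f(\xi,x_m(\xi))\,d\xi,\ m\ge0,$$ and its associated operator $$F(x(t))=(1+c_0)\,x(t)-c_0\Big(x_0^{(0)}+\int_{t_0}^{t}f(\xi,x(\xi))\,d\xi\Big).$$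 1. If $c_0\in[-1,0[$ then the sequence $\big\{\sum_{k=0}^{n}u_k(t)\big\}_n$ converges uniformly on $I$ to $x(t)$. 2. Let $J=[t_0-A,t_0+A]$, define $$S=\{x(t)\in C(J):|x(t)-x_0^{(0)}|\le b,\ |t-t_0|\le A\},$$ let $\tilde L$ be any constant with $\tilde L>L$, and consider the norm $$\|x\|_e=\max_{t\in J}\big|x(t)e^{-\tilde L|t-t_0|}\big|.$$ If $x(t)$ and $y(t)$ belong to $S$ and $c_0\in[-1,0[$ then $$\|F(x(t))-F(y(t))\|_e\le k\,\|x(t)-y(t)\|_e$$ with $$0<k=1+\Big(1-\frac{L}{\tilde L}\big(1-e^{-\tilde L A}\big)\Big)c_0<1.$$
   Context: $x_0^{(0)}\in\mathbb{R}$ is the prescribed initial value; the superscript $(0)$ is only part of its name. $f$ is real-valued, and the Lipschitz condition means $|f(t,x)-f(t,y)|\le L|x-y|$ for all $(t,x),(t,y)\in R$. The real number $c_0$ is called the convergence control parameter. $C(J)$ is the space of continuous real functions on $J$. $[-1,0[$ denotes the half-open interval $-1\le c_0<0$ and $]\alpha,\beta[$ denotes an open interval. $\mathbb{N}=\{1,2,\dots\}$.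
   Formalization: The bound 0<k is claimed only when L>0 or c_0>-1, since for L=0 and c_0=-1 one gets k=0; and when M=0, where b/M is undefined, A is taken to be a. *)

theory Defs
  imports "HOL-Analysis.Analysis"
begin

definition ivp_solution ::
  "(real \<times> real) set \<Rightarrow> (real \<times> real \<Rightarrow> real) \<Rightarrow> real \<Rightarrow> real \<Rightarrow> real set \<Rightarrow> (real \<Rightarrow> real) \<Rightarrow> bool"
where
  "ivp_solution D f t0 x0 I x \<longleftrightarrow>
     x t0 = x0 \<and>
     (\<forall>t\<in>I. (t, x t) \<in> D \<and> (x has_real_derivative f (t, x t)) (at t))"

text \<open>
  The IFOHAM recursion on an open interval \<open>I\<close> containing \<open>t0\<close>: each \<open>u (Suc m)\<close> solves the
  linear equation \<open>L[u (Suc m)] = c0 * (...)\<close>, where \<open>L\<close> is differentiation, and vanishes at \<open>t0\<close>.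
\<close>

definition ifoham_terms ::
  "(real \<times> real \<Rightarrow> real) \<Rightarrow> real \<Rightarrow> real \<Rightarrow> real \<Rightarrow> real set \<Rightarrow> (nat \<Rightarrow> real \<Rightarrow> real) \<Rightarrow> bool"
where
  "ifoham_terms f t0 x0 c0 I u \<longleftrightarrow>
     (\<forall>t\<in>I. u 0 t = x0) \<and>
     (\<forall>m. \<forall>t\<in>I. (u (Suc m) has_real_derivative
        c0 * ((\<Sum>k\<le>m. deriv (u k) t) - f (t, \<Sum>k\<le>m. u k t))) (at t)) \<and>
     (\<forall>k\<ge>1. u k t0 = 0)"

text \<open>
  All integrals from \<open>t0\<close> to \<open>t\<close> are signed interval integrals, so \<open>t < t0\<close> is allowed.
\<close>

primrec ifoham_iter ::
  "(real \<times> real \<Rightarrow> real) \<Rightarrow> real \<Rightarrow> real \<Rightarrow> real \<Rightarrow> nat \<Rightarrow> real \<Rightarrow> real"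
where
  "ifoham_iter f t0 x0 c0 0 = (\<lambda>t. x0)"
| "ifoham_iter f t0 x0 c0 (Suc m) = (\<lambda>t.
     x0 + (1 + c0) * (LBINT \<xi>=t0..t. deriv (ifoham_iter f t0 x0 c0 m) \<xi>)
        - c0 * (LBINT \<xi>=t0..t. f (\<xi>, ifoham_iter f t0 x0 c0 m \<xi>)))"

definition ifoham_op ::
  "(real \<times> real \<Rightarrow> real) \<Rightarrow> real \<Rightarrow> real \<Rightarrow> real \<Rightarrow> (real \<Rightarrow> real) \<Rightarrow> real \<Rightarrow> real"
where
  "ifoham_op f t0 x0 c0 x t =
     (1 + c0) * x t - c0 * (x0 + (LBINT \<xi>=t0..t. f (\<xi>, x \<xi>)))"

text \<open>
  The operator is the one-step map of the iteration, as long as the iterate is continuously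
  differentiable between \<open>t0\<close> and \<open>t\<close>.
\<close>

lemma ifoham_iter_Suc_eq_op:
  fixes f :: "real \<times> real \<Rightarrow> real" and t0 x0 c0 t :: real and m :: nat
  defines "y \<equiv> ifoham_iter f t0 x0 c0 m"
  assumes diff: "\<And>s. s \<in> {min t0 t..max t0 t} \<Longrightarrow> y field_differentiable at s"
    and cont: "continuous_on {min t0 t..max t0 t} (deriv y)"
  shows "ifoham_iter f t0 x0 c0 (Suc m) t = ifoham_op f t0 x0 c0 y t"
proof -
  have init: "y t0 = x0"
    unfolding y_def by (cases m) auto
  have "(LBINT \<xi>=t0..t. deriv y \<xi>) = y t - y t0"
  proof (rule interval_integral_FTC_finite[OF cont])
    fix s assume "min t0 t \<le> s" "s \<le> max t0 t"
    then have "(y has_field_derivative deriv y s) (at s)"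
      using diff by (simp add: field_differentiable_derivI)
    then show "(y has_vector_derivative deriv y s) (at s within {min t0 t..max t0 t})"
      by (simp add: has_real_derivative_iff_has_vector_derivative has_vector_derivative_at_within)
  qed
  then have yt: "y t = x0 + (LBINT \<xi>=t0..t. deriv y \<xi>)"
    by (simp add: init)
  show ?thesis
    unfolding ifoham_op_def yt
    by (simp add: y_def[symmetric]) (simp add: algebra_simps)
qed

text \<open>
  Weighted maximum norm over the compact set \<open>J\<close>; the supremum is attained for \<open>z\<close> continuous
  on \<open>J\<close>.
\<close>

definition exp_norm :: "real set \<Rightarrow> real \<Rightarrow> real \<Rightarrow> (real \<Rightarrow> real) \<Rightarrow> real" where
  "exp_norm J Lt t0 z = (SUP t\<in>J. \<bar>z t * exp (- Lt * \<bar>t - t0\<bar>)\<bar>)"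

end

theory Submission
  imports Defs
begin

text \<open>
  Both parts rest on one estimate: if \<open>h t0 = 0\<close> and \<open>\<bar>h'\<bar> \<le> C e\<^bsup>K\<bar>t - t0\<bar>\<^esup>\<close>, then
  \<open>\<bar>h\<bar> \<le> C (e\<^bsup>K\<bar>t - t0\<bar>\<^esup> - 1) / K\<close>. Applied to the primitive of \<open>f (t, x) - f (t, y)\<close> it gives the
  contraction in the weighted norm. The partial sums \<open>s n\<close> of IFOHAM satisfy
  \<open>s (n + 1)' = (1 + c0) s n' - c0 f (t, s n)\<close>, a convex combination, so \<open>\<bar>s n'\<bar> \<le> M\<close> persists and
  \<open>s n\<close> stays in the rectangle; since any solution stays there as well, the same estimate, applied to
  \<open>s (n + 1) - x - (1 + c0) (s n - x)\<close>, makes the weighted error decay geometrically.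
\<close>

section \<open>Estimates with an exponential weight\<close>

text \<open>Along the ray from \<open>t0\<close> to \<open>t\<close>, the function
  \<open>C / K * exp (K * s)\<close> of the distance \<open>s\<close> has exactly the bound on
  \<open>h'\<close> as its derivative, so the mean value inequality with a majorant applies.
  Derivatives are required only in the open interval and continuity on the closed one, so that
  \<open>t\<close> may be an endpoint.\<close>

lemma exp_growth_bound:
  fixes h h' :: "real \<Rightarrow> real"
  assumes K: "K > 0"
    and cont: "continuous_on {t0 - r..t0 + r} h"
    and deriv: "\<And>s. \<bar>s - t0\<bar> < r \<Longrightarrow> (h has_real_derivative h' s) (at s)"
    and bound: "\<And>s. \<bar>s - t0\<bar> < r \<Longrightarrow> \<bar>h' s\<bar> \<le> C * exp (K * \<bar>s - t0\<bar>)"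
    and t: "\<bar>t - t0\<bar> \<le> r"
    and init: "h t0 = 0"
  shows "\<bar>h t\<bar> \<le> C * (exp (K * \<bar>t - t0\<bar>) - 1) / K"
proof (cases "t = t0")
  case True
  then show ?thesis by (simp add: init)
next
  case False
  define d where "d = \<bar>t - t0\<bar>"
  \<comment> \<open>The points \<open>t0 + \<sigma> * s\<close> treat both sides of
    \<open>t0\<close> at once; \<open>t \<noteq> t0\<close> ensures
    \<open>\<bar>\<sigma>\<bar> = 1\<close>, so \<open>s\<close> is the distance to
    \<open>t0\<close>.\<close>
  define \<sigma> where "\<sigma> = sgn (t - t0)"
  have d: "0 < d" "d \<le> r" and \<sigma>: "\<bar>\<sigma>\<bar> = 1" and t_eq: "t = t0 + \<sigma> * d"
    using False t by (auto simp: d_def \<sigma>_def sgn_if)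
  have dist: "\<bar>(t0 + \<sigma> * s) - t0\<bar> = s" if "0 \<le> s" for s
    using that \<sigma> by (simp add: abs_mult)
  have "norm (h (t0 + \<sigma> * d) - h (t0 + \<sigma> * 0)) \<le> C / K * exp (K * d) - C / K * exp (K * 0)"
  proof (rule differentiable_bound_general[OF \<open>0 < d\<close>])
    show "continuous_on {0..d} (\<lambda>s. h (t0 + \<sigma> * s))"
    proof (rule continuous_on_compose2[OF cont])
      show "(\<lambda>s. t0 + \<sigma> * s) ` {0..d} \<subseteq> {t0 - r..t0 + r}"
        using dist d(2) by (fastforce simp: abs_le_iff)
    qed (intro continuous_intros)
    show "continuous_on {0..d} (\<lambda>s. C / K * exp (K * s))"
      by (intro continuous_intros)
    fix s assume s: "0 < s" "s < d"
    then have lt: "\<bar>(t0 + \<sigma> * s) - t0\<bar> < r"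
      using dist d(2) by simp
    have "((\<lambda>s. h (t0 + \<sigma> * s)) has_real_derivative h' (t0 + \<sigma> * s) * \<sigma>) (at s)"
      by (rule DERIV_chain2[where f = h and g = "\<lambda>s. t0 + \<sigma> * s", OF deriv[OF lt]]) (auto intro!: derivative_eq_intros)
    then show "((\<lambda>s. h (t0 + \<sigma> * s)) has_vector_derivative h' (t0 + \<sigma> * s) * \<sigma>) (at s)"
      by (simp add: has_real_derivative_iff_has_vector_derivative)
    have "((\<lambda>s. C / K * exp (K * s)) has_real_derivative C * exp (K * s)) (at s)"
      using K by (auto intro!: derivative_eq_intros)
    then show "((\<lambda>s. C / K * exp (K * s)) has_vector_derivative C * exp (K * s)) (at s)"
      by (simp add: has_real_derivative_iff_has_vector_derivative)
    show "norm (h' (t0 + \<sigma> * s) * \<sigma>) \<le> C * exp (K * s)"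
      using bound[OF lt] dist[of s] s \<sigma> by (simp add: abs_mult)
  qed
  then show ?thesis
    by (simp add: init t_eq[symmetric] d_def[symmetric] right_diff_distrib diff_divide_distrib)
qed

text \<open>One step turns an old error \<open>e\<close> into \<open>(1 + c0) * e - c0 * h\<close>,
  where \<open>h\<close> is the primitive of the difference of the right-hand sides. For
  \<open>c0\<close> in the given range both \<open>1 + c0\<close> and \<open>- c0\<close> are
  nonnegative, so the two bounds combine without loss of sign.\<close>

lemma damped_step_bound:
  fixes c0 :: real
  assumes c0: "c0 \<in> {-1..<0}" and L: "0 \<le> L" and K: "0 < K" and N: "0 \<le> N" and d: "d \<le> A"
    and e: "\<bar>e\<bar> \<le> N * exp (K * d)"
    and h: "\<bar>h\<bar> \<le> L * N * (exp (K * d) - 1) / K"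
  shows "\<bar>(1 + c0) * e - c0 * h\<bar> \<le> (1 + (1 - L / K * (1 - exp (- K * A))) * c0) * N * exp (K * d)"
proof -
  have "\<bar>(1 + c0) * e - c0 * h\<bar> \<le> (1 + c0) * \<bar>e\<bar> + (- c0) * \<bar>h\<bar>"
    using c0 abs_triangle_ineq4[of "(1 + c0) * e" "c0 * h"] by (simp add: abs_mult)
  also have "\<dots> \<le> (1 + c0) * (N * exp (K * d)) + (- c0) * (L * N * (exp (K * d) - 1) / K)"
    using c0 e h by (intro add_mono mult_left_mono) auto
  \<comment> \<open>Pulling out the weight leaves \<open>1 - exp (- K * d)\<close>, which increases
    with \<open>d\<close>; replacing \<open>d\<close> by \<open>A\<close> then makes the factor
    independent of the point.\<close>
  also have "\<dots> = (1 + c0) * (N * exp (K * d)) + (- c0) * (L / K * (1 - exp (- K * d)) * (N * exp (K * d)))"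
    by (simp add: algebra_simps exp_minus diff_divide_distrib)
  also have "\<dots> \<le> (1 + c0) * (N * exp (K * d)) + (- c0) * (L / K * (1 - exp (- K * A)) * (N * exp (K * d)))"
    using c0 L K N d by (intro add_mono mult_left_mono mult_right_mono order_refl) auto
  also have "\<dots> = (1 + (1 - L / K * (1 - exp (- K * A))) * c0) * N * exp (K * d)"
    by (simp add: algebra_simps)
  finally show ?thesis .
qed

lemma damped_factor_less_1:
  fixes c0 :: real
  assumes "c0 < 0" "0 \<le> L" "L < K"
  shows "1 + (1 - L / K * (1 - exp (- K * A))) * c0 < 1"
proof -
  have "L / K * (1 - exp (- K * A)) \<le> L / K"
    using assms by (intro mult_left_le) auto
  also have "L / K < 1"
    using assms by simp
  finally show ?thesis
    using assms by (simp add: mult_pos_neg)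
qed

text \<open>Yields a nonnegative factor whenever \<open>c0 \<ge> -1\<close>, including the case
  \<open>L = 0\<close>, \<open>c0 = -1\<close>, where the factor is exactly 0.\<close>

lemma damped_factor_ge:
  fixes c0 :: real
  assumes "c0 < 0" "0 \<le> L" "L < K" "0 \<le> A"
  shows "1 + c0 \<le> 1 + (1 - L / K * (1 - exp (- K * A))) * c0"
proof -
  have "0 \<le> L / K * (1 - exp (- K * A))"
    using assms by simp
  then have "L / K * (1 - exp (- K * A)) * c0 \<le> 0"
    using assms(1) by (intro mult_nonneg_nonpos) auto
  then show ?thesis
    by (simp only: left_diff_distrib mult_1_left)
qed

lemma damped_factor_pos:
  fixes c0 :: real
  assumes c0: "c0 \<in> {-1..<0}" and L: "0 \<le> L" "L < K" and A: "0 < A" and "L > 0 \<or> c0 > -1"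
  shows "0 < 1 + (1 - L / K * (1 - exp (- K * A))) * c0"
  using assms(5)
proof
  assume "L > 0"
  then have "0 < L / K * (1 - exp (- K * A))"
    using L A by (intro mult_pos_pos) auto
  then have "L / K * (1 - exp (- K * A)) * c0 < 0"
    using c0 by (intro mult_pos_neg) auto
  then have "1 + c0 < 1 + (1 - L / K * (1 - exp (- K * A))) * c0"
    by (simp only: left_diff_distrib mult_1_left)
  moreover have "0 \<le> 1 + c0"
    using c0 by simp
  ultimately show ?thesis
    by linarith
next
  assume "c0 > -1"
  then have "0 < 1 + c0" by simp
  also have "\<dots> \<le> 1 + (1 - L / K * (1 - exp (- K * A))) * c0"
    using c0 L A by (intro damped_factor_ge) auto
  finally show ?thesis .
qed

section \<open>Confinement of solutions to the rectangle\<close>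

text \<open>A first-exit argument: the bound on \<open>y'\<close> is available only while
  \<open>y\<close> is in the strip, hence up to the first time \<open>s\<close> at which the
  distance equals \<open>b\<close>. The mean value inequality on \<open>{0..s}\<close> then gives
  \<open>b \<le> M * s \<le> M * r < b\<close>.\<close>

lemma stays_in_strip:
  fixes y y' :: "real \<Rightarrow> real"
  assumes deriv: "\<And>s. 0 \<le> s \<Longrightarrow> s \<le> r \<Longrightarrow> (y has_real_derivative y' s) (at s)"
    and bound: "\<And>s. 0 \<le> s \<Longrightarrow> s \<le> r \<Longrightarrow> \<bar>y s - y 0\<bar> \<le> b \<Longrightarrow> \<bar>y' s\<bar> \<le> M"
    and M: "0 \<le> M" "M * r < b" and r: "0 \<le> r"
  shows "\<bar>y r - y 0\<bar> < b"
proof (rule ccontr)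
  assume far: "\<not> \<bar>y r - y 0\<bar> < b"
  have cont: "continuous_on {0..r} y"
    using deriv by (intro continuous_at_imp_continuous_on ballI) (auto intro: DERIV_isCont)
  have b: "0 < b"
    using M r mult_nonneg_nonneg[of M r] by linarith
  have "\<exists>s\<ge>0. s \<le> r \<and> \<bar>y s - y 0\<bar> = b \<and> (\<forall>q. 0 \<le> q \<and> q \<le> s \<longrightarrow> \<bar>y q - y 0\<bar> \<le> b)"
  proof -
    \<comment> \<open>The exit time is the least element of this compact set.\<close>
    define E where "E = {s \<in> {0..r}. b \<le> \<bar>y s - y 0\<bar>}"
    have "compact E"
    proof -
      have "closed E"
        unfolding E_def by (intro continuous_on_closed_Collect_le continuous_intros cont)
      moreover have "bounded E"
        unfolding E_def by (rule bounded_subset[OF bounded_closed_interval[of 0 r]]) auto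
      ultimately show ?thesis
        by (simp add: compact_eq_bounded_closed)
    qed
    moreover have "r \<in> E"
      using far r by (simp add: E_def)
    ultimately obtain s where s: "s \<in> E" "\<And>q. q \<in> E \<Longrightarrow> s \<le> q"
      using compact_attains_inf[of E] by blast
    \<comment> \<open>The distance is 0 at time 0 and at least \<open>b\<close> at \<open>s\<close>,
      so it equals \<open>b\<close> at some \<open>p \<le> s\<close>; then \<open>p\<close> lies in
      \<open>E\<close>, and minimality forces \<open>p = s\<close>.\<close>
    obtain p where p: "0 \<le> p" "p \<le> s" "\<bar>y p - y 0\<bar> = b"
    proof -
      have "\<exists>p\<ge>0. p \<le> s \<and> \<bar>y p - y 0\<bar> = b"
        using s(1) b unfolding E_def
        by (intro IVT' continuous_intros continuous_on_subset[OF cont]) auto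
      then show ?thesis using that by blast
    qed
    then have "p = s"
      using s unfolding E_def by force
    moreover have "\<bar>y q - y 0\<bar> \<le> b" if "0 \<le> q" "q \<le> s" for q
    proof (cases "q \<in> E")
      case True
      then have "q = s" using s(2) that by force
      then show ?thesis using p \<open>p = s\<close> by simp
    next
      case False
      then show ?thesis using that s(1) by (auto simp: E_def)
    qed
    ultimately show ?thesis
      using p s(1) by (auto simp: E_def)
  qed
  then obtain s where s: "0 \<le> s" "s \<le> r" "\<bar>y s - y 0\<bar> = b"
      and before: "\<And>q. 0 \<le> q \<Longrightarrow> q \<le> s \<Longrightarrow> \<bar>y q - y 0\<bar> \<le> b"
    by blast
  have "norm (y s - y 0) \<le> M * norm (s - 0)"
  proof (rule field_differentiable_bound[of "{0..s}"])
    fix q assume q: "q \<in> {0..s}"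
    show "(y has_field_derivative y' q) (at q within {0..s})"
      using q s by (intro has_field_derivative_at_within[OF deriv]) auto
    show "norm (y' q) \<le> M"
      using q s bound before by simp
  qed (use s in auto)
  then have "b \<le> M * s"
    using s by simp
  also have "\<dots> \<le> M * r"
    using s M by (simp add: mult_left_mono)
  finally show False
    using M by simp
qed

text \<open>The rectangle is already cut down to half-width \<open>A\<close>. The product form
  \<open>M * A \<le> b\<close> replaces a bound by \<open>b / M\<close> and makes sense for
  \<open>M = 0\<close> too.\<close>

locale ivp_rectangle =
  fixes f :: "real \<times> real \<Rightarrow> real" and t0 x0 A b M L :: real
  assumes A_pos: "0 < A" and b_pos: "0 < b" and M_nonneg: "0 \<le> M" and MA: "M * A \<le> b"
    and f_bound: "\<And>t x. \<bar>t - t0\<bar> \<le> A \<Longrightarrow> \<bar>x - x0\<bar> \<le> b \<Longrightarrow> \<bar>f (t, x)\<bar> \<le> M"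
    and f_Lipschitz: "\<And>t x y. \<bar>t - t0\<bar> \<le> A \<Longrightarrow> \<bar>x - x0\<bar> \<le> b \<Longrightarrow> \<bar>y - x0\<bar> \<le> b \<Longrightarrow>
          \<bar>f (t, x) - f (t, y)\<bar> \<le> L * \<bar>x - y\<bar>"
    and L_nonneg: "0 \<le> L"
begin

text \<open>A solution is only known to have its graph in \<open>D\<close>, so
  \<open>f_bound\<close> and \<open>f_Lipschitz\<close> do not apply to it at once. The exit
  argument along the ray from \<open>t0\<close> to \<open>t\<close> supplies the missing
  confinement.\<close>

lemma ivp_solution_in_strip:
  assumes sol: "ivp_solution D f t0 x0 {t0 - A<..<t0 + A} x" and t: "\<bar>t - t0\<bar> < A"
  shows "\<bar>x t - x0\<bar> \<le> b"
proof -
  define \<sigma> where "\<sigma> = sgn (t - t0)"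
  have t_eq: "t = t0 + \<sigma> * \<bar>t - t0\<bar>" and \<sigma>: "\<bar>\<sigma>\<bar> \<le> 1"
    by (auto simp: \<sigma>_def sgn_if)
  have xt0: "x t0 = x0"
    using sol by (simp add: ivp_solution_def)
  have near: "\<bar>(t0 + \<sigma> * s) - t0\<bar> < A" if "0 \<le> s" "s \<le> \<bar>t - t0\<bar>" for s
    using that \<sigma> t mult_right_mono[of "\<bar>\<sigma>\<bar>" 1 "\<bar>s\<bar>"] by (simp add: abs_mult)
  have "\<bar>x (t0 + \<sigma> * \<bar>t - t0\<bar>) - x (t0 + \<sigma> * 0)\<bar> < b"
  proof (rule stays_in_strip[where M = M and y' = "\<lambda>s. f (t0 + \<sigma> * s, x (t0 + \<sigma> * s)) * \<sigma>"])
    fix s assume s: "0 \<le> s" "s \<le> \<bar>t - t0\<bar>"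
    have "t0 + \<sigma> * s \<in> {t0 - A<..<t0 + A}"
      using near[OF s] by (auto simp: abs_less_iff)
    then have "(x has_real_derivative f (t0 + \<sigma> * s, x (t0 + \<sigma> * s))) (at (t0 + \<sigma> * s))"
      using sol unfolding ivp_solution_def by blast
    then show "((\<lambda>s. x (t0 + \<sigma> * s)) has_real_derivative f (t0 + \<sigma> * s, x (t0 + \<sigma> * s)) * \<sigma>) (at s)"
      by (rule DERIV_chain2[where f = x and g = "\<lambda>s. t0 + \<sigma> * s"]) (auto intro!: derivative_eq_intros)
    assume "\<bar>x (t0 + \<sigma> * s) - x (t0 + \<sigma> * 0)\<bar> \<le> b"
    then have "\<bar>f (t0 + \<sigma> * s, x (t0 + \<sigma> * s))\<bar> \<le> M"
      using near[OF s] xt0 by (intro f_bound) auto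
    then have "\<bar>f (t0 + \<sigma> * s, x (t0 + \<sigma> * s))\<bar> * \<bar>\<sigma>\<bar> \<le> M * 1"
      using \<sigma> M_nonneg by (intro mult_mono) auto
    then show "\<bar>f (t0 + \<sigma> * s, x (t0 + \<sigma> * s)) * \<sigma>\<bar> \<le> M"
      by (simp add: abs_mult)
  next
    \<comment> \<open>Strictness comes from \<open>b > 0\<close> if \<open>M = 0\<close>, and
      otherwise from \<open>\<bar>t - t0\<bar> < A\<close>.\<close>
    show "M * \<bar>t - t0\<bar> < b"
    proof (cases "M = 0")
      case True
      then show ?thesis using b_pos by simp
    next
      case False
      then have "M * \<bar>t - t0\<bar> < M * A"
        using M_nonneg t by simp
      then show ?thesis using MA by simp
    qed
  qed (use M_nonneg in auto)
  then show ?thesis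
    by (simp add: t_eq[symmetric] xt0)
qed

section \<open>Partial sums of IFOHAM: confinement and convergence\<close>

lemma ifoham_partial_sum_init:
  assumes "ifoham_terms f t0 x0 c0 {t0 - A<..<t0 + A} u"
  shows "(\<Sum>k\<le>n. u k t0) = x0"
proof -
  have "u 0 t0 = x0" "u (Suc m) t0 = 0" for m
    using assms A_pos unfolding ifoham_terms_def by simp_all
  then show ?thesis
    by (induction n) simp_all
qed

text \<open>The term \<open>u 0\<close> is prescribed on the interval only, so the derivative of the
  constant is transferred using that the interval is open.\<close>

lemma ifoham_term_0_has_deriv:
  assumes u: "ifoham_terms f t0 x0 c0 {t0 - A<..<t0 + A} u" and t: "t \<in> {t0 - A<..<t0 + A}"
  shows "(u 0 has_real_derivative 0) (at t)"
proof -
  have "((\<lambda>_. x0) has_real_derivative 0) (at t)"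
    by simp
  then show ?thesis
    by (rule has_field_derivative_transform_within_open[OF _ open_greaterThanLessThan t])
       (use u in \<open>auto simp: ifoham_terms_def\<close>)
qed

lemma ifoham_terms_deriv:
  assumes u: "ifoham_terms f t0 x0 c0 {t0 - A<..<t0 + A} u" and t: "t \<in> {t0 - A<..<t0 + A}"
  shows "(u k has_real_derivative deriv (u k) t) (at t)"
proof -
  have "\<exists>d. (u k has_real_derivative d) (at t)"
  proof (cases k)
    case 0
    then show ?thesis using ifoham_term_0_has_deriv[OF u t] by blast
  next
    case (Suc m)
    then show ?thesis using u t unfolding ifoham_terms_def by blast
  qed
  then show ?thesis
    by (metis DERIV_imp_deriv)
qed

lemma ifoham_deriv_Suc:
  assumes u: "ifoham_terms f t0 x0 c0 {t0 - A<..<t0 + A} u" and t: "t \<in> {t0 - A<..<t0 + A}"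
  shows "deriv (u (Suc m)) t = c0 * ((\<Sum>k\<le>m. deriv (u k) t) - f (t, \<Sum>k\<le>m. u k t))"
  by (rule DERIV_imp_deriv) (rule u[unfolded ifoham_terms_def, THEN conjunct2, THEN conjunct1, rule_format, OF t])

lemma ifoham_partial_sum_has_deriv:
  assumes u: "ifoham_terms f t0 x0 c0 {t0 - A<..<t0 + A} u" and t: "t \<in> {t0 - A<..<t0 + A}"
  shows "((\<lambda>t. \<Sum>k\<le>n. u k t) has_real_derivative (\<Sum>k\<le>n. deriv (u k) t)) (at t)"
  by (rule DERIV_sum[where f = "\<lambda>t k. u k t" and f' = "\<lambda>k. deriv (u k) t"])
     (rule ifoham_terms_deriv[OF u t])

text \<open>The invariant of the induction is the bound \<open>M\<close> on the derivative of the
  partial sum. Confinement follows from it by the mean value inequality and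
  \<open>M * A \<le> b\<close>, and in turn bounds \<open>f\<close> along the partial sum, as the
  next step requires.\<close>

lemma ifoham_partial_sum_in_strip:
  assumes u: "ifoham_terms f t0 x0 c0 {t0 - A<..<t0 + A} u" and c0: "c0 \<in> {-1..<0}"
    and t: "t \<in> {t0 - A<..<t0 + A}"
  shows "\<bar>(\<Sum>k\<le>n. u k t) - x0\<bar> \<le> b"
proof -
  have strip: "\<bar>(\<Sum>k\<le>n. u k t) - x0\<bar> \<le> b"
    if d: "\<And>t. t \<in> {t0 - A<..<t0 + A} \<Longrightarrow> \<bar>\<Sum>k\<le>n. deriv (u k) t\<bar> \<le> M"
      and t: "t \<in> {t0 - A<..<t0 + A}" for n t
  proof -
    have "norm ((\<Sum>k\<le>n. u k t) - (\<Sum>k\<le>n. u k t0)) \<le> M * norm (t - t0)"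
      by (rule field_differentiable_bound[of "{t0 - A<..<t0 + A}"])
         (use d t A_pos in \<open>auto intro: has_field_derivative_at_within[OF ifoham_partial_sum_has_deriv[OF u]]\<close>)
    also have "\<dots> \<le> M * A"
      using t M_nonneg by (intro mult_left_mono) auto
    also have "\<dots> \<le> b"
      by (rule MA)
    finally show ?thesis
      by (simp add: ifoham_partial_sum_init[OF u])
  qed
  have "\<bar>\<Sum>k\<le>n. deriv (u k) t\<bar> \<le> M" if "t \<in> {t0 - A<..<t0 + A}" for t
    using that
  proof (induction n arbitrary: t)
    case 0
    then show ?case
      using DERIV_imp_deriv[OF ifoham_term_0_has_deriv[OF u 0]] M_nonneg by simp
  next
    case (Suc n)
    define s where "s = (\<Sum>k\<le>n. deriv (u k) t)"
    define g where "g = f (t, \<Sum>k\<le>n. u k t)"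
    have "\<bar>g\<bar> \<le> M"
      unfolding g_def using Suc.prems by (intro f_bound strip[OF Suc.IH]) auto
    \<comment> \<open>The new term contributes \<open>c0 * (s - g)\<close>; added to
      \<open>s\<close> it gives a convex combination of \<open>s\<close> and
      \<open>g\<close>.\<close>
    have "\<bar>(\<Sum>k\<le>Suc n. deriv (u k) t)\<bar> = \<bar>(1 + c0) * s - c0 * g\<bar>"
      by (simp add: ifoham_deriv_Suc[OF u Suc.prems] s_def g_def algebra_simps)
    also have "\<dots> \<le> (1 + c0) * \<bar>s\<bar> + (- c0) * \<bar>g\<bar>"
      using c0 abs_triangle_ineq4[of "(1 + c0) * s" "c0 * g"] by (simp add: abs_mult)
    also have "\<dots> \<le> (1 + c0) * M + (- c0) * M"
      using c0 Suc.IH[OF Suc.prems] \<open>\<bar>g\<bar> \<le> M\<close>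
      by (intro add_mono mult_left_mono) (auto simp: s_def)
    also have "\<dots> = M"
      by (simp add: algebra_simps)
    finally show ?case .
  qed
  then show ?thesis
    using strip t by blast
qed

text \<open>The constant \<open>b\<close> is the initial error: the zeroth sum is the center of the
  strip that contains the solution. Each step then gains the damping factor in the weighted
  bound.\<close>

lemma ifoham_geometric_error:
  assumes sol: "ivp_solution D f t0 x0 {t0 - A<..<t0 + A} x"
    and u: "ifoham_terms f t0 x0 c0 {t0 - A<..<t0 + A} u" and c0: "c0 \<in> {-1..<0}"
    and K: "L < K"
    and t: "t \<in> {t0 - A<..<t0 + A}"
  shows "\<bar>(\<Sum>k\<le>n. u k t) - x t\<bar>
           \<le> b * (1 + (1 - L / K * (1 - exp (- K * A))) * c0) ^ n * exp (K * \<bar>t - t0\<bar>)"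
  using t
proof (induction n arbitrary: t)
  case 0
  have "\<bar>(\<Sum>k\<le>0. u k t) - x t\<bar> \<le> b * 1"
    using ivp_solution_in_strip[OF sol, of t] u 0 by (auto simp: ifoham_terms_def abs_minus_commute)
  also have "\<dots> \<le> b * exp (K * \<bar>t - t0\<bar>)"
    using b_pos K L_nonneg by (intro mult_left_mono) auto
  finally show ?case by simp
next
  case (Suc n)
  define k where "k = 1 + (1 - L / K * (1 - exp (- K * A))) * c0"
  define N where "N = b * k ^ n"
  define s where "s n t = (\<Sum>k\<le>n. u k t)" for n t
  \<comment> \<open>Solving the one-step relation for its integral term gives the primitive of
    \<open>f (q, s n q) - f (q, x q)\<close> vanishing at \<open>t0\<close>, without forming an
    integral.\<close>
  define g where "g t = (1 / c0) * ((1 + c0) * (s n t - x t) - (s (Suc n) t - x t))" for t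
  have "1 + c0 \<le> k"
    unfolding k_def using c0 K L_nonneg A_pos by (intro damped_factor_ge) auto
  then have k: "0 \<le> k"
    using c0 by simp
  have g_deriv: "(g has_real_derivative f (q, s n q) - f (q, x q)) (at q)"
    if q: "q \<in> {t0 - A<..<t0 + A}" for q
  proof -
    have "(x has_real_derivative f (q, x q)) (at q)"
      using sol q by (simp add: ivp_solution_def)
    moreover note ifoham_partial_sum_has_deriv[OF u q, of n, folded s_def]
      ifoham_partial_sum_has_deriv[OF u q, of "Suc n", folded s_def]
    ultimately have "(g has_real_derivative
        (1 / c0) * ((1 + c0) * ((\<Sum>k\<le>n. deriv (u k) q) - f (q, x q))
           - ((\<Sum>k\<le>Suc n. deriv (u k) q) - f (q, x q)))) (at q)"
      unfolding g_def by (intro DERIV_cmult DERIV_diff)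
    also have "(1 / c0) * ((1 + c0) * ((\<Sum>k\<le>n. deriv (u k) q) - f (q, x q))
           - ((\<Sum>k\<le>Suc n. deriv (u k) q) - f (q, x q))) = f (q, s n q) - f (q, x q)"
      using c0 by (simp add: ifoham_deriv_Suc[OF u q] s_def field_simps)
    finally show ?thesis .
  qed
  have "\<bar>g t\<bar> \<le> L * N * (exp (K * \<bar>t - t0\<bar>) - 1) / K"
  \<comment> \<open>With this radius the closed interval stays inside the open one, where
    \<open>g\<close> is differentiable.\<close>
  proof (rule exp_growth_bound[where r = "\<bar>t - t0\<bar>" and h' = "\<lambda>q. f (q, s n q) - f (q, x q)"])
    show "0 < K" using K L_nonneg by simp
    show "g t0 = 0"
      using sol by (simp add: g_def s_def ifoham_partial_sum_init[OF u] ivp_solution_def del: sum.atMost_Suc)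
    show "continuous_on {t0 - \<bar>t - t0\<bar>..t0 + \<bar>t - t0\<bar>} g"
      using Suc.prems
      by (intro continuous_at_imp_continuous_on ballI DERIV_isCont[OF g_deriv]) (auto simp: abs_if split: if_splits)
    fix q assume q: "\<bar>q - t0\<bar> < \<bar>t - t0\<bar>"
    then have qI: "q \<in> {t0 - A<..<t0 + A}"
      using Suc.prems by (auto simp: abs_if split: if_splits)
    then show "(g has_real_derivative f (q, s n q) - f (q, x q)) (at q)"
      by (rule g_deriv)
    have qA: "\<bar>q - t0\<bar> < A"
      using qI by (auto simp: abs_if)
    have "\<bar>f (q, s n q) - f (q, x q)\<bar> \<le> L * \<bar>s n q - x q\<bar>"
      using qA unfolding s_def
      by (intro f_Lipschitz ifoham_partial_sum_in_strip[OF u c0 qI] ivp_solution_in_strip[OF sol]) auto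
    also have "\<dots> \<le> L * (N * exp (K * \<bar>q - t0\<bar>))"
      unfolding N_def k_def s_def by (intro mult_left_mono Suc.IH[OF qI] L_nonneg)
    finally show "\<bar>f (q, s n q) - f (q, x q)\<bar> \<le> L * N * exp (K * \<bar>q - t0\<bar>)"
      by (simp add: mult.assoc)
  qed simp
  then have "\<bar>(1 + c0) * (s n t - x t) - c0 * g t\<bar> \<le> k * N * exp (K * \<bar>t - t0\<bar>)"
    unfolding k_def using Suc.IH[OF Suc.prems] Suc.prems K L_nonneg k b_pos
    by (intro damped_step_bound[OF c0 L_nonneg]) (auto simp: N_def k_def s_def)
  moreover have "(1 + c0) * (s n t - x t) - c0 * g t = s (Suc n) t - x t"
    using c0 by (simp add: g_def)
  ultimately show ?case
    unfolding k_def[symmetric] by (simp add: s_def N_def mult_ac)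
qed

lemma ifoham_uniform_limit:
  assumes sol: "ivp_solution D f t0 x0 {t0 - A<..<t0 + A} x"
    and u: "ifoham_terms f t0 x0 c0 {t0 - A<..<t0 + A} u" and c0: "c0 \<in> {-1..<0}"
  shows "uniform_limit {t0 - A<..<t0 + A} (\<lambda>n t. \<Sum>k\<le>n. u k t) x sequentially"
proof -
  \<comment> \<open>Any positive \<open>K > L\<close> would serve. The weight is at most
    \<open>exp (K * A)\<close> on the interval, so geometric decay of the weighted error is uniform
    decay.\<close>
  define K where "K = L + 1"
  define k where "k = 1 + (1 - L / K * (1 - exp (- K * A))) * c0"
  have K: "L < K" "0 \<le> K"
    using L_nonneg by (auto simp: K_def)
  have "1 + c0 \<le> k" "k < 1"
    unfolding k_def using c0 K L_nonneg A_pos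
    by (intro damped_factor_ge damped_factor_less_1; simp)+
  then have k: "0 \<le> k" "k < 1"
    using c0 by auto
  show ?thesis
  proof (rule uniform_limitI)
    fix \<epsilon> :: real assume "\<epsilon> > 0"
    have "(\<lambda>n. b * k ^ n * exp (K * A)) \<longlonglongrightarrow> b * 0 * exp (K * A)"
      using k by (intro tendsto_intros LIMSEQ_power_zero) auto
    then have "\<forall>\<^sub>F n in sequentially. b * k ^ n * exp (K * A) < \<epsilon>"
      by (rule order_tendstoD(2)) (use \<open>\<epsilon> > 0\<close> in simp)
    then show "\<forall>\<^sub>F n in sequentially. \<forall>t\<in>{t0 - A<..<t0 + A}. dist (\<Sum>k\<le>n. u k t) (x t) < \<epsilon>"
    proof (rule eventually_mono, intro ballI)
      fix n t assume small: "b * k ^ n * exp (K * A) < \<epsilon>" and t: "t \<in> {t0 - A<..<t0 + A}"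
      have "\<bar>(\<Sum>k\<le>n. u k t) - x t\<bar> \<le> b * k ^ n * exp (K * \<bar>t - t0\<bar>)"
        unfolding k_def by (rule ifoham_geometric_error[OF sol u c0 K(1) t])
      also have "\<dots> \<le> b * k ^ n * exp (K * A)"
        using t K k b_pos by (auto intro!: mult_left_mono)
      finally show "dist (\<Sum>k\<le>n. u k t) (x t) < \<epsilon>"
        using small by (simp add: dist_real_def)
    qed
  qed
qed

section \<open>Contraction of the operator in the weighted norm\<close>

lemma ifoham_op_contraction:
  fixes x y :: "real \<Rightarrow> real"
  defines "J \<equiv> {t0 - A..t0 + A}"
  assumes f_cont: "continuous_on (J \<times> {x0 - b..x0 + b}) f"
    and x: "continuous_on J x" "\<And>t. t \<in> J \<Longrightarrow> \<bar>x t - x0\<bar> \<le> b"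
    and y: "continuous_on J y" "\<And>t. t \<in> J \<Longrightarrow> \<bar>y t - x0\<bar> \<le> b"
    and c0: "c0 \<in> {-1..<0}" and K: "L < K"
  shows "exp_norm J K t0 (\<lambda>t. ifoham_op f t0 x0 c0 x t - ifoham_op f t0 x0 c0 y t)
           \<le> (1 + (1 - L / K * (1 - exp (- K * A))) * c0) * exp_norm J K t0 (\<lambda>t. x t - y t)"
proof -
  define k where "k = 1 + (1 - L / K * (1 - exp (- K * A))) * c0"
  define N where "N = exp_norm J K t0 (\<lambda>t. x t - y t)"
  define h where "h t = (LBINT \<xi>=t0..t. f (\<xi>, x \<xi>)) - (LBINT \<xi>=t0..t. f (\<xi>, y \<xi>))" for t
  have K0: "0 < K" using K L_nonneg by simp
  have J: "t \<in> J \<longleftrightarrow> \<bar>t - t0\<bar> \<le> A" for t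
    by (auto simp: J_def abs_le_iff)
  \<comment> \<open>The norm is a supremum, so reading off a pointwise bound requires boundedness,
    which compactness of \<open>J\<close> provides.\<close>
  have e: "\<bar>x t - y t\<bar> \<le> N * exp (K * \<bar>t - t0\<bar>)" if "t \<in> J" for t
  proof -
    have "compact J" by (simp add: J_def)
    then have "bdd_above ((\<lambda>t. \<bar>(x t - y t) * exp (- K * \<bar>t - t0\<bar>)\<bar>) ` J)"
      by (intro bounded_imp_bdd_above compact_imp_bounded compact_continuous_image continuous_intros x y)
    then have "\<bar>(x t - y t) * exp (- K * \<bar>t - t0\<bar>)\<bar> \<le> N"
      unfolding N_def exp_norm_def using that by (intro cSUP_upper)
    then show ?thesis
      by (simp add: abs_mult exp_minus field_simps)
  qed
  have N: "0 \<le> N"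
    using e[of t0] A_pos J[of t0] by (auto intro: order_trans[OF abs_ge_zero])
  have comp: "continuous_on J (\<lambda>t. f (t, z t))"
    if "continuous_on J z" "\<And>t. t \<in> J \<Longrightarrow> \<bar>z t - x0\<bar> \<le> b" for z
    by (rule continuous_on_compose2[OF f_cont])
       (use that in \<open>fastforce intro!: continuous_intros simp: abs_le_iff\<close>)+
  \<comment> \<open>At the endpoints of \<open>J\<close> this derivative is one-sided. It yields
    continuity of \<open>h\<close> on all of \<open>J\<close>, and in the interior it becomes
    two-sided.\<close>
  have int: "((\<lambda>t. LBINT \<xi>=t0..t. f (\<xi>, z \<xi>)) has_real_derivative f (t, z t)) (at t within J)"
    if "continuous_on J z" "\<And>t. t \<in> J \<Longrightarrow> \<bar>z t - x0\<bar> \<le> b" "t \<in> J" for z t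
    unfolding J_def has_real_derivative_iff_has_vector_derivative
    by (rule interval_integral_FTC2) (use A_pos comp[OF that(1,2)] that(3) in \<open>auto simp: J_def\<close>)
  have h_deriv: "(h has_real_derivative f (t, x t) - f (t, y t)) (at t within J)" if "t \<in> J" for t
    unfolding h_def by (intro DERIV_diff int x y that)
  have h: "\<bar>h t\<bar> \<le> L * N * (exp (K * \<bar>t - t0\<bar>) - 1) / K" if "t \<in> J" for t
  proof (rule exp_growth_bound[where r = A and h' = "\<lambda>t. f (t, x t) - f (t, y t)", OF K0])
    show "continuous_on {t0 - A..t0 + A} h"
      by (rule DERIV_continuous_on[OF h_deriv[unfolded J_def]])
    show "h t0 = 0" by (simp add: h_def)
    show "\<bar>t - t0\<bar> \<le> A" using that J by simp
    fix s assume s: "\<bar>s - t0\<bar> < A"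
    then have sJ: "s \<in> J" and "s \<in> interior J"
      by (auto simp: J_def abs_less_iff)
    show "(h has_real_derivative f (s, x s) - f (s, y s)) (at s)"
      using h_deriv[OF sJ] unfolding at_within_interior[OF \<open>s \<in> interior J\<close>] .
    have "\<bar>f (s, x s) - f (s, y s)\<bar> \<le> L * \<bar>x s - y s\<bar>"
      using s sJ x y by (intro f_Lipschitz) auto
    also have "\<dots> \<le> L * (N * exp (K * \<bar>s - t0\<bar>))"
      by (intro mult_left_mono e sJ L_nonneg)
    finally show "\<bar>f (s, x s) - f (s, y s)\<bar> \<le> L * N * exp (K * \<bar>s - t0\<bar>)"
      by (simp add: mult.assoc)
  qed
  have "exp_norm J K t0 (\<lambda>t. ifoham_op f t0 x0 c0 x t - ifoham_op f t0 x0 c0 y t) \<le> k * N"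
    unfolding exp_norm_def
  proof (rule cSUP_least)
    show "J \<noteq> {}" using A_pos by (simp add: J_def)
    fix t assume t: "t \<in> J"
    have "ifoham_op f t0 x0 c0 x t - ifoham_op f t0 x0 c0 y t = (1 + c0) * (x t - y t) - c0 * h t"
      by (simp add: ifoham_op_def h_def algebra_simps)
    moreover have "\<bar>(1 + c0) * (x t - y t) - c0 * h t\<bar> \<le> k * N * exp (K * \<bar>t - t0\<bar>)"
      unfolding k_def using t J by (intro damped_step_bound[OF c0 L_nonneg K0 N _ e h]) auto
    ultimately show "\<bar>(ifoham_op f t0 x0 c0 x t - ifoham_op f t0 x0 c0 y t) * exp (- K * \<bar>t - t0\<bar>)\<bar> \<le> k * N"
      by (simp add: abs_mult exp_minus field_simps)
  qed
  then show ?thesis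
    by (simp add: k_def N_def)
qed

end

section \<open>From the given domain to the rectangle estimates\<close>

text \<open>Division by zero gives 0, so \<open>A\<close> is set to \<open>a\<close> explicitly when
  \<open>M = 0\<close>. Positivity of the factor excludes \<open>L = 0\<close> with
  \<open>c0 = -1\<close>, where it is exactly 0.\<close>

theorem proposition5:
  fixes D R :: "(real \<times> real) set"
    and f :: "real \<times> real \<Rightarrow> real"
    and t0 x0 a b L M A c0 :: real
    and I J :: "real set"
    and S :: "(real \<Rightarrow> real) set"
  assumes "open D"
    and "(t0, x0) \<in> D"
    and "a > 0" and "b > 0"
    and R_eq: "R = {(t, x). \<bar>t - t0\<bar> \<le> a \<and> \<bar>x - x0\<bar> \<le> b}"
    and "R \<subseteq> D"
    and "continuous_on D f"
    and Lipschitz: "\<forall>t x y. (t, x) \<in> R \<longrightarrow> (t, y) \<in> R \<longrightarrow> \<bar>f (t, x) - f (t, y)\<bar> \<le> L * \<bar>x - y\<bar>"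
    and M_eq: "M = (SUP p\<in>R. \<bar>f p\<bar>)"
    and A_eq: "A = (if M = 0 then a else min a (b / M))"
    and I_eq: "I = {t0 - A<..<t0 + A}"
    and J_eq: "J = {t0 - A..t0 + A}"
    and S_eq: "S = {x. continuous_on J x \<and> (\<forall>t\<in>J. \<bar>x t - x0\<bar> \<le> b)}"
    and c0: "c0 \<in> {-1..<0}"
  shows
    "(\<forall>x u. ivp_solution D f t0 x0 I x \<longrightarrow> ifoham_terms f t0 x0 c0 I u \<longrightarrow>
        uniform_limit I (\<lambda>n t. \<Sum>k\<le>n. u k t) x sequentially)
     \<and>
     (\<forall>Lt > L. let k = 1 + (1 - L / Lt * (1 - exp (- Lt * A))) * c0 in
        (\<forall>x\<in>S. \<forall>y\<in>S.
           exp_norm J Lt t0 (\<lambda>t. ifoham_op f t0 x0 c0 x t - ifoham_op f t0 x0 c0 y t)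
             \<le> k * exp_norm J Lt t0 (\<lambda>t. x t - y t)) \<and>
        (L > 0 \<or> c0 > -1 \<longrightarrow> 0 < k) \<and> k < 1)"
proof -
  have R_Times: "R = cball t0 a \<times> cball x0 b"
    by (auto simp: R_eq dist_real_def abs_minus_commute)
  have "compact R"
    unfolding R_Times by (intro compact_Times compact_cball)
  moreover have "continuous_on R f"
    using \<open>continuous_on D f\<close> \<open>R \<subseteq> D\<close> by (rule continuous_on_subset)
  ultimately have "bdd_above ((\<lambda>p. \<bar>f p\<bar>) ` R)"
    by (intro bounded_imp_bdd_above compact_imp_bounded compact_continuous_image continuous_intros)
  then have f_le: "\<bar>f p\<bar> \<le> M" if "p \<in> R" for p
    unfolding M_eq using that by (rule cSUP_upper2) simp
  have "(t0, x0) \<in> R"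
    using \<open>a > 0\<close> \<open>b > 0\<close> by (simp add: R_eq)
  then have M: "0 \<le> M"
    using f_le by (force intro: order_trans[OF abs_ge_zero])
  have A: "0 < A" "A \<le> a" "M * A \<le> b"
    using M \<open>a > 0\<close> \<open>b > 0\<close> by (auto simp: A_eq min_def field_simps)
  \<comment> \<open>Testing the Lipschitz condition at two distinct points of \<open>R\<close> shows
    that \<open>L\<close> cannot be negative.\<close>
  have "\<bar>f (t0, x0 + b) - f (t0, x0)\<bar> \<le> L * b"
    using Lipschitz[rule_format, of t0 "x0 + b" x0] \<open>a > 0\<close> \<open>b > 0\<close> by (simp add: R_eq)
  then have L: "0 \<le> L"
    using \<open>b > 0\<close> by (metis abs_ge_zero order_trans zero_le_mult_iff not_less)
  have bound: "\<bar>f (t, x)\<bar> \<le> M" if "\<bar>t - t0\<bar> \<le> A" "\<bar>x - x0\<bar> \<le> b" for t x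
    using that A by (intro f_le) (simp add: R_eq)
  have Lip: "\<bar>f (t, x) - f (t, y)\<bar> \<le> L * \<bar>x - y\<bar>"
    if "\<bar>t - t0\<bar> \<le> A" "\<bar>x - x0\<bar> \<le> b" "\<bar>y - x0\<bar> \<le> b" for t x y
    using that A by (intro Lipschitz[rule_format]) (simp_all add: R_eq)
  have f_cont: "continuous_on ({t0 - A..t0 + A} \<times> {x0 - b..x0 + b}) f"
    by (rule continuous_on_subset[OF \<open>continuous_on R f\<close>]) (use A in \<open>auto simp: R_eq abs_le_iff\<close>)
  interpret ivp_rectangle f t0 x0 A b M L
    by unfold_locales (fact A(1) \<open>b > 0\<close> M A(3) bound Lip L)+
  show ?thesis
    unfolding Let_def I_eq
  proof (intro conjI allI impI ballI)
    fix x u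
    assume "ivp_solution D f t0 x0 {t0 - A<..<t0 + A} x"
      and "ifoham_terms f t0 x0 c0 {t0 - A<..<t0 + A} u"
    then show "uniform_limit {t0 - A<..<t0 + A} (\<lambda>n t. \<Sum>k\<le>n. u k t) x sequentially"
      by (rule ifoham_uniform_limit[OF _ _ c0])
  next
    fix Lt x y assume "L < Lt" "x \<in> S" "y \<in> S"
    then show "exp_norm J Lt t0 (\<lambda>t. ifoham_op f t0 x0 c0 x t - ifoham_op f t0 x0 c0 y t)
        \<le> (1 + (1 - L / Lt * (1 - exp (- Lt * A))) * c0) * exp_norm J Lt t0 (\<lambda>t. x t - y t)"
      unfolding J_eq S_eq by (intro ifoham_op_contraction[OF f_cont _ _ _ _ c0]) auto
  next
    fix Lt assume "L < Lt" "L > 0 \<or> c0 > -1"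
    then show "0 < 1 + (1 - L / Lt * (1 - exp (- Lt * A))) * c0"
      using damped_factor_pos[OF c0 L _ A(1)] by blast
  next
    fix Lt assume "L < Lt"
    then show "1 + (1 - L / Lt * (1 - exp (- Lt * A))) * c0 < 1"
      using c0 L by (intro damped_factor_less_1) auto
  qed
qed

end
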